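(* Define the polynomials $p_m$ by $p_0(t)=t$ and $p_{m+1}(t)=\tfrac12p_m(t)\bigl(3-p_m(t)^2\bigr)$ for $m\ge0$, and let $\gamma\in(0,1]$. For $t\in[\gamma,1]$, define the scalar sign error $\varepsilon_m(t)=1-p_m(t)$. Then, for every $m\ge0$, $p_m$ maps $[0,1]$ into itself, is increasing on $[0,1]$, and $$\varepsilon_{m+1}(t)=\tfrac12\varepsilon_m(t)^2\bigl(3-\varepsilon_m(t)\bigr)\le\tfrac32\varepsilon_m(t)^2\qquad(t\in[\gamma,1]).$$ Consequently, if a symmetric matrix $A$ has spectrum contained in $[-1,-\gamma]\cup[\gamma,1]$, then $$\|p_m(A)-\operatorname{sign}(A)\|_2\le\max_{|u|\in[\gamma,1]}|p_m(u)-\operatorname{sign}(u)|=\varepsilon_m(\gamma).$$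
   Context: For a symmetric matrix $A=Q\operatorname{diag}(\mu_i)Q^T$ ($Q$ orthogonal) with no zero eigenvalue, $\operatorname{sign}(A)=Q\operatorname{diag}(\operatorname{sign}(\mu_i))Q^T$. $\|\cdot\|_2$ is the spectral norm. *)

theory Defs
  imports "HOL-Analysis.Analysis" "HOL-Computational_Algebra.Polynomial"
begin

fun sign_poly :: "nat \<Rightarrow> real poly" where
  "sign_poly 0 = [:0, 1:]"
| "sign_poly (Suc m) = smult (1/2) (sign_poly m * ([:3:] - (sign_poly m)\<^sup>2))"

definition sign_error :: "nat \<Rightarrow> real \<Rightarrow> real" where
  "sign_error m t = 1 - poly (sign_poly m) t"

(* On the type real^'n^'n the operators * and ^ act entrywise, so powers with
   respect to the matrix product ** have to be introduced separately. *)
primrec matrix_pow :: "real^'n^'n \<Rightarrow> nat \<Rightarrow> real^'n^'n" where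
  "matrix_pow A 0 = mat 1"
| "matrix_pow A (Suc k) = A ** matrix_pow A k"

definition poly_matrix :: "real poly \<Rightarrow> real^'n^'n \<Rightarrow> real^'n^'n" where
  "poly_matrix p A = (\<Sum>k\<le>degree p. coeff p k *\<^sub>R matrix_pow A k)"

(* Real eigenvalues only; for symmetric A, the only case used, this is the whole
   (complex) spectrum. *)
definition matrix_spectrum :: "real^'n^'n \<Rightarrow> real set" where
  "matrix_spectrum A = {c. \<exists>v. v \<noteq> 0 \<and> A *v v = c *\<^sub>R v}"

definition diag_matrix :: "real^'n \<Rightarrow> real^'n^'n" where
  "diag_matrix d = (\<chi> i j. if i = j then d $ i else 0)"

definition is_matrix_sign :: "real^'n^'n \<Rightarrow> real^'n^'n \<Rightarrow> bool" where
  "is_matrix_sign A S \<longleftrightarrow>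
     (\<exists>Q d. orthogonal_matrix Q \<and> (\<forall>i. d $ i \<noteq> 0) \<and>
        A = Q ** diag_matrix d ** transpose Q \<and>
        S = Q ** diag_matrix (\<chi> i. sgn (d $ i)) ** transpose Q)"

(* Unspecified unless A is symmetric without zero eigenvalue; on such A the choice of
   the decomposition is immaterial, see matrix_sign_eq below. *)
definition matrix_sign :: "real^'n^'n \<Rightarrow> real^'n^'n" where
  "matrix_sign A = (THE S. is_matrix_sign A S)"

definition spectral_norm :: "real^'n^'n \<Rightarrow> real" where
  "spectral_norm A = onorm (\<lambda>x. A *v x)"

definition is_max_over :: "('a \<Rightarrow> real) \<Rightarrow> 'a set \<Rightarrow> real \<Rightarrow> bool" where
  "is_max_over f U M \<longleftrightarrow> M \<in> f ` U \<and> (\<forall>u\<in>U. f u \<le> M)"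

lemma diag_matrix_mult_left: "(diag_matrix d ** W) $ i $ j = d $ i * W $ i $ j"
  by (simp add: diag_matrix_def matrix_matrix_mult_def if_distrib if_distribR cong: if_cong)

lemma diag_matrix_mult_right: "(W ** diag_matrix d) $ i $ j = W $ i $ j * d $ j"
  by (simp add: diag_matrix_def matrix_matrix_mult_def if_distrib if_distribR cong: if_cong)

lemma is_matrix_sign_unique:
  assumes "is_matrix_sign A S" "is_matrix_sign A T"
  shows "S = T"
proof -
  have conj_eq_iff: "Q ** D ** transpose Q = P ** E ** transpose P \<longleftrightarrow>
      (transpose P ** Q) ** D = E ** (transpose P ** Q)"
    if Q: "orthogonal_matrix Q" and P: "orthogonal_matrix P" for Q P D E :: "real^'n^'n"
  proof
    assume "Q ** D ** transpose Q = P ** E ** transpose P"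
    then have "transpose P ** (Q ** D ** transpose Q) ** Q
        = transpose P ** (P ** E ** transpose P) ** Q" by simp
    then have "(transpose P ** Q) ** D ** (transpose Q ** Q)
        = (transpose P ** P) ** E ** (transpose P ** Q)"
      by (simp add: matrix_mul_assoc)
    then show "(transpose P ** Q) ** D = E ** (transpose P ** Q)"
      using Q P by (simp add: orthogonal_matrix_def)
  next
    assume "(transpose P ** Q) ** D = E ** (transpose P ** Q)"
    then have "P ** ((transpose P ** Q) ** D) ** transpose Q
        = P ** (E ** (transpose P ** Q)) ** transpose Q" by simp
    then have "(P ** transpose P) ** Q ** D ** transpose Q
        = P ** E ** transpose P ** (Q ** transpose Q)"
      by (simp add: matrix_mul_assoc)
    then show "Q ** D ** transpose Q = P ** E ** transpose P"
      using Q P by (simp add: orthogonal_matrix_def)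
  qed
  obtain Q d where Q: "orthogonal_matrix Q" "A = Q ** diag_matrix d ** transpose Q"
      "S = Q ** diag_matrix (\<chi> i. sgn (d $ i)) ** transpose Q"
    using assms(1) unfolding is_matrix_sign_def by blast
  obtain P e where P: "orthogonal_matrix P" "A = P ** diag_matrix e ** transpose P"
      "T = P ** diag_matrix (\<chi> i. sgn (e $ i)) ** transpose P"
    using assms(2) unfolding is_matrix_sign_def by blast
  define W where "W = transpose P ** Q"
  have "W ** diag_matrix d = diag_matrix e ** W"
    using conj_eq_iff[OF Q(1) P(1)] Q(2) P(2) unfolding W_def by metis
  then have "W $ i $ j * d $ j = e $ i * W $ i $ j" for i j
    by (metis diag_matrix_mult_left diag_matrix_mult_right)
  then have "W $ i $ j = 0 \<or> d $ j = e $ i" for i j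
    by (metis mult.commute mult_left_cancel)
  then have "W $ i $ j * sgn (d $ j) = sgn (e $ i) * W $ i $ j" for i j
    by (metis mult.commute mult_zero_left)
  then have "W ** diag_matrix (\<chi> i. sgn (d $ i)) = diag_matrix (\<chi> i. sgn (e $ i)) ** W"
    by (simp add: vec_eq_iff diag_matrix_mult_left diag_matrix_mult_right)
  then show ?thesis
    using conj_eq_iff[OF Q(1) P(1)] Q(3) P(3) unfolding W_def by metis
qed

lemma matrix_sign_eq:
  assumes "orthogonal_matrix Q" "\<And>i. d $ i \<noteq> 0"
  shows "matrix_sign (Q ** diag_matrix d ** transpose Q)
       = Q ** diag_matrix (\<chi> i. sgn (d $ i)) ** transpose Q"
proof -
  have "is_matrix_sign (Q ** diag_matrix d ** transpose Q)
      (Q ** diag_matrix (\<chi> i. sgn (d $ i)) ** transpose Q)"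
    using assms unfolding is_matrix_sign_def by blast
  then show ?thesis
    unfolding matrix_sign_def by (blast intro: the_equality is_matrix_sign_unique)
qed

end

theory Submission
  imports Defs
begin

text \<open>One step of the iteration is \<open>x \<mapsto> x (3 - x\<^sup>2) / 2\<close>. On the unit interval it is strictly
  increasing and fixes both 0 and 1, so by induction every iterate is an increasing map of the unit
  interval into itself. In terms of the error \<open>1 - x\<close> the step is \<open>e \<mapsto> e\<^sup>2 (3 - e) / 2\<close>, because
  1 is a critical point of the step; since the error is nonnegative, dropping \<open>- e\<close> gives the
  quadratic bound. As every iterate is odd, the error in approximating \<open>sgn u\<close> depends only on
  \<open>\<bar>u\<bar>\<close>, and by monotonicity it is largest at the smallest admissible modulus \<open>\<gamma>\<close>.

  The matrix bound reduces to this scalar bound by diagonalizing: in an orthonormal basis of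
  eigenvectors of \<open>A\<close>, the difference of \<open>p(A)\<close> and the matrix sign is diagonal, with entries
  \<open>p(\<mu>) - sgn \<mu>\<close> at the eigenvalues \<open>\<mu>\<close>, and orthogonal changes of basis do not affect the
  spectral norm (\<open>spectral_norm_poly_matrix_minus_sign_le\<close>). The existence of such a basis is the
  spectral theorem for real symmetric matrices (\<open>symmetric_matrix_diagonalization\<close>), obtained by
  maximizing the quadratic form of \<open>A\<close> over the unit spheres of invariant subspaces.\<close>

section \<open>The scalar iteration\<close>

lemma poly_sign_poly_Suc:
  "poly (sign_poly (Suc m)) t = 1/2 * poly (sign_poly m) t * (3 - (poly (sign_poly m) t)\<^sup>2)"
  by (simp add: power2_eq_square)

lemma newton_schulz_step_strict_mono:
  fixes x y :: real
  assumes "0 \<le> x" "x < y" "y \<le> 1"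
  shows "1/2 * x * (3 - x\<^sup>2) < 1/2 * y * (3 - y\<^sup>2)"
proof -
  have "x * x \<le> x * y" "x * y < y * y" "y * y \<le> 1"
    using assms by (auto intro: mult_left_mono mult_strict_right_mono mult_le_one)
  then have "0 < 3 - x\<^sup>2 - x * y - y\<^sup>2"
    unfolding power2_eq_square by linarith
  then have "0 < (y - x) * (3 - x\<^sup>2 - x * y - y\<^sup>2)"
    using assms by simp
  \<comment> \<open>The difference of the two values of the cubic, with its factor \<open>y - x\<close> split off.\<close>
  also have "\<dots> = 2 * (1/2 * y * (3 - y\<^sup>2) - 1/2 * x * (3 - x\<^sup>2))"
    by (simp add: power2_eq_square algebra_simps)
  finally show ?thesis by simp
qed

lemma sign_poly_at_0: "poly (sign_poly m) 0 = 0"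
  by (induction m) auto

lemma sign_poly_at_1: "poly (sign_poly m) 1 = 1"
  by (induction m) auto

text \<open>The two properties need each other in the induction: the step is increasing only as long as the
  previous iterate stays in the unit interval, and the iterate stays there because it is increasing
  and fixes the end points.\<close>

lemma sign_poly_strict_mono_range:
  "strict_mono_on {0..1} (poly (sign_poly m)) \<and> poly (sign_poly m) ` {0..1} \<subseteq> {0..1}"
proof (induction m)
  case 0
  then show ?case by (auto intro: strict_mono_onI)
next
  case (Suc m)
  have mono: "strict_mono_on {0..1} (poly (sign_poly (Suc m)))"
  proof (rule strict_mono_onI)
    fix r s :: real
    assume rs: "r \<in> {0..1}" "s \<in> {0..1}" "r < s"
    have "poly (sign_poly m) r < poly (sign_poly m) s"
      using Suc rs strict_mono_onD by blast
    moreover have "poly (sign_poly m) r \<in> {0..1}" "poly (sign_poly m) s \<in> {0..1}"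
      using Suc rs by blast+
    ultimately show "poly (sign_poly (Suc m)) r < poly (sign_poly (Suc m)) s"
      unfolding poly_sign_poly_Suc by (intro newton_schulz_step_strict_mono) auto
  qed
  have "poly (sign_poly (Suc m)) t \<in> {0..1}" if "t \<in> {0..1}" for t
  proof -
    have "poly (sign_poly (Suc m)) 0 \<le> poly (sign_poly (Suc m)) t"
      "poly (sign_poly (Suc m)) t \<le> poly (sign_poly (Suc m)) 1"
      using that by (auto intro!: strict_mono_on_leD[OF mono] simp del: sign_poly.simps)
    then show ?thesis
      unfolding sign_poly_at_0 sign_poly_at_1 by simp
  qed
  with mono show ?case by blast
qed

lemma sign_poly_mono:
  assumes "0 \<le> s" "s \<le> t" "t \<le> 1"
  shows "poly (sign_poly m) s \<le> poly (sign_poly m) t"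
  using sign_poly_strict_mono_range[of m] assms by (auto intro: strict_mono_on_leD)

lemma sign_poly_odd: "poly (sign_poly m) (- t) = - poly (sign_poly m) t"
  by (induction m) auto

lemma sign_error_nonneg:
  assumes "0 \<le> t" "t \<le> 1"
  shows "0 \<le> sign_error m t"
  using sign_poly_mono[of t 1 m] assms by (simp add: sign_error_def sign_poly_at_1)

lemma sign_error_Suc:
  "sign_error (Suc m) t = 1/2 * (sign_error m t)\<^sup>2 * (3 - sign_error m t)"
  unfolding sign_error_def poly_sign_poly_Suc
  by (simp add: power2_eq_square field_simps)

lemma sign_poly_approx_sgn:
  assumes "0 < \<bar>u\<bar>" "\<bar>u\<bar> \<le> 1"
  shows "\<bar>poly (sign_poly m) u - sgn u\<bar> = sign_error m \<bar>u\<bar>"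
proof (cases "u > 0")
  case True
  then show ?thesis
    using sign_error_nonneg[of u m] assms by (simp add: sign_error_def)
next
  case False
  then show ?thesis
    using sign_error_nonneg[of "- u" m] sign_poly_odd[of m u] assms
    by (simp add: sign_error_def)
qed

lemma sign_poly_max_error:
  assumes "0 < \<gamma>" "\<gamma> \<le> 1"
  shows "is_max_over (\<lambda>u. \<bar>poly (sign_poly m) u - sgn u\<bar>) {u. \<bar>u\<bar> \<in> {\<gamma>..1}} (sign_error m \<gamma>)"
  unfolding is_max_over_def
proof (intro conjI ballI)
  have "sign_error m \<gamma> = \<bar>poly (sign_poly m) \<gamma> - sgn \<gamma>\<bar>"
    using sign_poly_approx_sgn[of \<gamma> m] assms by simp
  then show "sign_error m \<gamma> \<in> (\<lambda>u. \<bar>poly (sign_poly m) u - sgn u\<bar>) ` {u. \<bar>u\<bar> \<in> {\<gamma>..1}}"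
    using assms by (intro image_eqI[of _ _ \<gamma>]) auto
next
  fix u :: real
  assume "u \<in> {u. \<bar>u\<bar> \<in> {\<gamma>..1}}"
  then show "\<bar>poly (sign_poly m) u - sgn u\<bar> \<le> sign_error m \<gamma>"
    using sign_poly_approx_sgn[of u m] sign_poly_mono[of \<gamma> "\<bar>u\<bar>" m] assms
    by (cases "u = 0") (simp_all add: sign_error_def)
qed

section \<open>Orthogonal diagonalization of symmetric matrices\<close>

lemma symmetric_matrix_inner:
  fixes A :: "real^'n^'n"
  assumes "transpose A = A"
  shows "(A *v x) \<bullet> y = x \<bullet> (A *v y)"
  using dot_lmul_matrix[of x A y] assms by (metis transpose_matrix_vector)

text \<open>A maximizer of the quadratic form on the unit sphere of the subspace is an eigenvector: with
  \<open>c\<close> the maximum, the form \<open>q x = c (x \<bullet> x) - x \<bullet> A x\<close> is nonnegative on the subspace and vanishes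
  at the maximizer \<open>v\<close>, so its first variation at \<open>v\<close> in the direction \<open>c v - A v\<close> has to vanish.\<close>

lemma symmetric_matrix_eigenvector_in_subspace:
  fixes A :: "real^'n^'n"
  assumes sym: "transpose A = A" and V: "subspace V" "V \<noteq> {0}"
    and inv: "\<And>x. x \<in> V \<Longrightarrow> A *v x \<in> V"
  obtains v c where "v \<in> V" "norm v = 1" "A *v v = c *\<^sub>R v"
proof -
  let ?K = "V \<inter> sphere 0 1"
  obtain z where z: "z \<in> V" "z \<noteq> 0"
    using V subspace_0 by blast
  then have "(1 / norm z) *\<^sub>R z \<in> ?K"
    using V by (auto simp: subspace_scale)
  moreover have "compact ?K"
    using V by (intro closed_Int_compact closed_subspace) auto
  moreover have "continuous_on ?K (\<lambda>x. x \<bullet> (A *v x))"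
    by (intro continuous_intros)
  ultimately obtain v where v: "v \<in> ?K" and max: "\<And>x. x \<in> ?K \<Longrightarrow> x \<bullet> (A *v x) \<le> v \<bullet> (A *v v)"
    using continuous_attains_sup[of ?K "\<lambda>x. x \<bullet> (A *v x)"] by blast
  define c where "c = v \<bullet> (A *v v)"
  define q where "q x = c * (x \<bullet> x) - x \<bullet> (A *v x)" for x
  have q_nonneg: "q x \<ge> 0" if "x \<in> V" for x
  proof (cases "x = 0")
    case False
    define u where "u = (1 / norm x) *\<^sub>R x"
    have u: "u \<in> ?K"
      using that False V by (auto simp: u_def subspace_scale)
    have x: "x = norm x *\<^sub>R u"
      using False by (simp add: u_def)
    have "q x = (norm x)\<^sup>2 * (c * (u \<bullet> u) - u \<bullet> (A *v u))"
      unfolding q_def by (subst (1 2 3 4) x)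
        (simp add: matrix_vector_mult_scaleR power2_eq_square algebra_simps)
    also have "u \<bullet> u = 1"
      using u by (simp add: dot_square_norm)
    finally show ?thesis
      using max[OF u] by (simp add: c_def)
  qed (simp add: q_def)
  define w where "w = c *\<^sub>R v - A *v v"
  have w: "w \<in> V"
    using v inv V by (auto simp: w_def subspace_diff subspace_scale)
  have vv: "v \<bullet> v = 1"
    using v by (simp add: dot_square_norm)
  have expand: "q (v + t *\<^sub>R w) = 2 * t * (w \<bullet> w) + t\<^sup>2 * q w" for t
  proof -
    have "v \<bullet> (A *v w) = w \<bullet> (A *v v)"
      using symmetric_matrix_inner[OF sym, of v w] by (simp add: inner_commute)
    then have "q (v + t *\<^sub>R w) = q v + 2 * t * (c * (w \<bullet> v) - w \<bullet> (A *v v)) + t\<^sup>2 * q w"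
      by (simp add: q_def matrix_vector_right_distrib matrix_vector_mult_scaleR inner_add
          inner_commute[of v w] power2_eq_square algebra_simps)
    also have "c * (w \<bullet> v) - w \<bullet> (A *v v) = w \<bullet> w"
      by (subst (4) w_def) (simp add: inner_diff_right)
    also have "q v = 0"
      using vv by (simp add: q_def c_def)
    finally show ?thesis by simp
  qed
  have "w \<bullet> w = 0"
  proof (rule ccontr)
    assume "w \<bullet> w \<noteq> 0"
    then have pos: "w \<bullet> w > 0" by simp
    have qw: "q w \<ge> 0" using q_nonneg[OF w] .
    \<comment> \<open>A negative step so short that the linear term dominates the quadratic one.\<close>
    define t where "t = - (w \<bullet> w) / (q w + 1)"
    have t: "t < 0" using pos qw by (simp add: t_def divide_neg_pos)
    have "t * q w \<ge> - (w \<bullet> w)"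
      using pos qw by (simp add: t_def field_simps)
    then have "2 * (w \<bullet> w) + t * q w > 0"
      using pos by linarith
    then have "t * (2 * (w \<bullet> w) + t * q w) < 0"
      using t by (simp add: mult_neg_pos)
    then have "q (v + t *\<^sub>R w) < 0"
      unfolding expand by (simp add: power2_eq_square algebra_simps)
    moreover have "v + t *\<^sub>R w \<in> V"
      using v w V by (auto simp: subspace_add subspace_scale)
    ultimately show False
      using q_nonneg[of "v + t *\<^sub>R w"] by linarith
  qed
  then have "A *v v = c *\<^sub>R v"
    by (simp add: w_def)
  then show thesis
    using that[of v c] v by simp
qed

text \<open>An orthonormal set of eigenvectors of largest size is a basis: its orthogonal complement is
  invariant under the matrix and would otherwise supply one more eigenvector.\<close>

lemma symmetric_matrix_orthonormal_eigenbasis: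
  fixes A :: "real^'n^'n"
  assumes sym: "transpose A = A"
  obtains S where "finite S" "card S = CARD('n)" "pairwise orthogonal S"
    "\<And>v. v \<in> S \<Longrightarrow> norm v = 1" "\<And>v. v \<in> S \<Longrightarrow> \<exists>c. A *v v = c *\<^sub>R v"
proof -
  define P where "P S \<longleftrightarrow> pairwise orthogonal S \<and>
    (\<forall>v\<in>S. norm v = 1 \<and> (\<exists>c. A *v v = c *\<^sub>R v))" for S :: "(real^'n) set"
  have indep: "independent S" if "P S" for S
    using that by (intro pairwise_orthogonal_independent) (auto simp: P_def)
  have bound: "finite S \<and> card S \<le> CARD('n)" if "P S" for S
    using independent_bound[OF indep[OF that]] by simp
  have "P {}" by (simp add: P_def pairwise_def)
  with bound obtain S where S: "P S" and max: "\<And>T. P T \<Longrightarrow> card T \<le> card S"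
    using ex_has_greatest_nat[of P "{}" card "Suc CARD('n)"] by (auto simp: less_Suc_eq_le)
  have "card S = CARD('n)"
  proof (rule ccontr)
    assume "card S \<noteq> CARD('n)"
    then have "dim S < DIM(real^'n)"
      using bound[OF S] dim_eq_card_independent[OF indep[OF S]] by simp
    then obtain x where x: "x \<noteq> 0" "\<And>y. y \<in> span S \<Longrightarrow> orthogonal x y"
      using orthogonal_to_subspace_exists by blast
    define V where "V = {x. \<forall>s\<in>S. s \<bullet> x = 0}"
    have "subspace V"
      by (auto simp: V_def subspace_def inner_add_right)
    moreover have "x \<in> V"
      using x by (auto simp: V_def orthogonal_def span_base inner_commute)
    moreover have "A *v y \<in> V" if "y \<in> V" for y
    proof -
      have "s \<bullet> (A *v y) = 0" if "s \<in> S" for s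
      proof -
        obtain c where "A *v s = c *\<^sub>R s"
          using S \<open>s \<in> S\<close> by (auto simp: P_def)
        then show ?thesis
          using symmetric_matrix_inner[OF sym, of s y] \<open>y \<in> V\<close> \<open>s \<in> S\<close> by (simp add: V_def)
      qed
      then show ?thesis by (simp add: V_def)
    qed
    ultimately obtain v c where v: "v \<in> V" "norm v = 1" "A *v v = c *\<^sub>R v"
      using symmetric_matrix_eigenvector_in_subspace[OF sym, of V] x(1) by blast
    then have "v \<notin> S"
      by (auto simp: V_def)
    moreover have "P (insert v S)"
      using S v by (auto simp: P_def V_def pairwise_insert orthogonal_def inner_commute)
    ultimately show False
      using max[of "insert v S"] bound[OF S] by simp
  qed
  with that bound S show thesis
    unfolding P_def by blast
qed

lemma matrix_mult_diag_iff_eigenvectors: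
  fixes A Q :: "real^'n^'n"
  shows "A ** Q = Q ** diag_matrix d \<longleftrightarrow> (\<forall>j. A *v column j Q = d $ j *\<^sub>R column j Q)"
proof -
  have "(A ** Q) $ i $ j = (A *v column j Q) $ i" for i j
    by (simp add: matrix_matrix_mult_def matrix_vector_mult_def column_def)
  moreover have "(Q ** diag_matrix d) $ i $ j = (d $ j *\<^sub>R column j Q) $ i" for i j
    by (simp add: diag_matrix_mult_right column_def)
  ultimately show ?thesis
    unfolding vec_eq_iff by metis
qed

text \<open>This turns an identity between a matrix and a diagonalization into a check on each column of
  \<open>Q\<close>, which is how polynomials in a matrix and its sign are compared below.\<close>

lemma diagonalization_iff_eigenvectors:
  fixes A Q :: "real^'n^'n"
  assumes "orthogonal_matrix Q"
  shows "A = Q ** diag_matrix d ** transpose Q \<longleftrightarrow>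
    (\<forall>j. A *v column j Q = d $ j *\<^sub>R column j Q)"
proof -
  have "A = Q ** diag_matrix d ** transpose Q \<longleftrightarrow> A ** Q = Q ** diag_matrix d"
    using assms unfolding orthogonal_matrix_def
    by (metis matrix_mul_assoc matrix_mul_rid)
  then show ?thesis
    by (simp add: matrix_mult_diag_iff_eigenvectors)
qed

theorem symmetric_matrix_diagonalization:
  fixes A :: "real^'n^'n"
  assumes "transpose A = A"
  obtains Q d where "orthogonal_matrix Q" "A = Q ** diag_matrix d ** transpose Q"
proof -
  obtain S where S: "finite S" "card S = CARD('n)" "pairwise orthogonal S"
    "\<And>v. v \<in> S \<Longrightarrow> norm v = 1" "\<And>v. v \<in> S \<Longrightarrow> \<exists>c. A *v v = c *\<^sub>R v"
    using symmetric_matrix_orthonormal_eigenbasis[OF assms] by blast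
  obtain f :: "'n \<Rightarrow> real^'n" where f: "bij_betw f UNIV S"
    using finite_same_card_bij[of "UNIV :: 'n set" S] S by auto
  then have fS: "f j \<in> S" and f_inj: "f i = f j \<longleftrightarrow> i = j" for i j
    by (auto simp: bij_betw_def inj_on_def)
  obtain e where e: "\<And>j. A *v f j = e j *\<^sub>R f j"
    using choice[of "\<lambda>j c. A *v f j = c *\<^sub>R f j"] S(5)[OF fS] by blast
  define Q where "Q = (\<chi> i j. f j $ i)"
  have col: "column j Q = f j" for j
    by (simp add: Q_def column_def vec_eq_iff)
  have Q: "orthogonal_matrix Q"
    unfolding orthogonal_matrix_orthonormal_columns col
    using S(3,4) fS f_inj by (auto simp: pairwise_def)
  moreover have "A = Q ** diag_matrix (\<chi> j. e j) ** transpose Q"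
    using e by (simp add: diagonalization_iff_eigenvectors[OF Q] col)
  ultimately show thesis
    using that by blast
qed

section \<open>Functions of a symmetric matrix and their spectral norm\<close>

lemma matrix_pow_eigenvector:
  assumes "A *v v = c *\<^sub>R v"
  shows "matrix_pow A k *v v = c ^ k *\<^sub>R v"
  by (induction k)
    (simp_all add: assms matrix_vector_mult_scaleR flip: matrix_vector_mul_assoc)

lemma poly_matrix_eigenvector:
  assumes "A *v v = c *\<^sub>R v"
  shows "poly_matrix p A *v v = poly p c *\<^sub>R v"
proof -
  have "(\<Sum>k\<in>K. B k) *v v = (\<Sum>k\<in>K. B k *v v)" if "finite K" for K and B :: "nat \<Rightarrow> real^'a^'a"
    using that by (induction K) (auto simp: matrix_vector_mult_add_rdistrib)
  then show ?thesis
    by (simp add: poly_matrix_def poly_altdef scaleR_matrix_vector_assoc[symmetric]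
        matrix_pow_eigenvector[OF assms] scaleR_sum_left)
qed

lemma spectral_norm_diagonalization_le:
  fixes Q :: "real^'n^'n"
  assumes Q: "orthogonal_matrix Q" and d: "\<And>i. \<bar>d $ i\<bar> \<le> M"
  shows "spectral_norm (Q ** diag_matrix d ** transpose Q) \<le> M"
  unfolding spectral_norm_def
proof (rule onorm_le)
  fix x :: "real^'n"
  have isometry: "norm (P *v y) = norm y" if "orthogonal_matrix P" for P :: "real^'n^'n" and y
    using that orthogonal_transformation_norm[of "(*v) P" y]
    by (simp add: orthogonal_transformation_matrix matrix_of_matrix_vector_mul)
  have M: "0 \<le> M" using d[of undefined] by linarith
  have diag: "norm (diag_matrix d *v y) \<le> M * norm y" for y
  proof -
    have "(diag_matrix d *v y) $ i = d $ i * y $ i" for i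
      by (simp add: diag_matrix_def matrix_vector_mult_def if_distrib if_distribR cong: if_cong)
    then have "norm ((diag_matrix d *v y) $ i) \<le> norm ((M *\<^sub>R y) $ i)" for i
      using d[of i] M by (simp add: abs_mult mult_right_mono)
    then have "norm (diag_matrix d *v y) \<le> norm (M *\<^sub>R y)"
      by (rule norm_le_componentwise_cart)
    then show ?thesis using M by simp
  qed
  have "norm ((Q ** diag_matrix d ** transpose Q) *v x)
      = norm (diag_matrix d *v (transpose Q *v x))"
    using isometry[OF Q] by (simp flip: matrix_vector_mul_assoc)
  also have "\<dots> \<le> M * norm (transpose Q *v x)"
    by (rule diag)
  also have "\<dots> = M * norm x"
    using isometry[of "transpose Q"] Q by simp
  finally show "norm ((Q ** diag_matrix d ** transpose Q) *v x) \<le> M * norm x" .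
qed

text \<open>In an orthonormal eigenbasis of \<open>A\<close> both \<open>p(A)\<close> and the matrix sign are diagonal, so the
  matrix error is at most the largest scalar error at an eigenvalue.\<close>

lemma spectral_norm_poly_matrix_minus_sign_le:
  fixes A :: "real^'n^'n"
  assumes sym: "transpose A = A" and nonzero: "0 \<notin> matrix_spectrum A"
    and bound: "\<And>c. c \<in> matrix_spectrum A \<Longrightarrow> \<bar>poly p c - sgn c\<bar> \<le> M"
  shows "spectral_norm (poly_matrix p A - matrix_sign A) \<le> M"
proof -
  obtain Q d where Q: "orthogonal_matrix Q" and A: "A = Q ** diag_matrix d ** transpose Q"
    using symmetric_matrix_diagonalization[OF sym] by blast
  have eig: "A *v column j Q = d $ j *\<^sub>R column j Q" for j
    using diagonalization_iff_eigenvectors[OF Q] A by blast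
  have "column j Q \<noteq> 0" for j
    using Q by (metis orthogonal_matrix_orthonormal_columns norm_zero zero_neq_one)
  with eig have spec: "d $ j \<in> matrix_spectrum A" for j
    unfolding matrix_spectrum_def by blast
  have "d $ j \<noteq> 0" for j
    using spec[of j] nonzero by auto
  then have "matrix_sign A = Q ** diag_matrix (\<chi> j. sgn (d $ j)) ** transpose Q"
    using matrix_sign_eq[OF Q] A by blast
  then have sign: "matrix_sign A *v column j Q = sgn (d $ j) *\<^sub>R column j Q" for j
    using diagonalization_iff_eigenvectors[OF Q] by simp
  have "poly_matrix p A - matrix_sign A
      = Q ** diag_matrix (\<chi> j. poly p (d $ j) - sgn (d $ j)) ** transpose Q"
    unfolding diagonalization_iff_eigenvectors[OF Q]
    by (simp add: matrix_vector_mult_diff_rdistrib poly_matrix_eigenvector[OF eig] sign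
        scaleR_diff_left)
  then show ?thesis
    using spectral_norm_diagonalization_le[OF Q] bound spec by simp
qed

theorem proposition3p6:
  fixes \<gamma> :: real and m :: nat
  assumes "0 < \<gamma>" and "\<gamma> \<le> 1"
  shows "poly (sign_poly m) ` {0..1} \<subseteq> {0..1} \<and>
    strict_mono_on {0..1} (poly (sign_poly m)) \<and>
    (\<forall>t\<in>{\<gamma>..1}.
       sign_error (Suc m) t = 1/2 * (sign_error m t)\<^sup>2 * (3 - sign_error m t) \<and>
       1/2 * (sign_error m t)\<^sup>2 * (3 - sign_error m t) \<le> 3/2 * (sign_error m t)\<^sup>2) \<and>
    (\<exists>M. is_max_over (\<lambda>u. \<bar>poly (sign_poly m) u - sgn u\<bar>) {u. \<bar>u\<bar> \<in> {\<gamma>..1}} M \<and>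
       (\<forall>A :: real^'n^'n.
          transpose A = A \<longrightarrow> matrix_spectrum A \<subseteq> {-1..-\<gamma>} \<union> {\<gamma>..1} \<longrightarrow>
          spectral_norm (poly_matrix (sign_poly m) A - matrix_sign A) \<le> M) \<and>
       M = sign_error m \<gamma>)"
proof (intro conjI ballI exI[of _ "sign_error m \<gamma>"] allI impI refl)
  show "poly (sign_poly m) ` {0..1} \<subseteq> {0..1}" "strict_mono_on {0..1} (poly (sign_poly m))"
    using sign_poly_strict_mono_range by blast+
  show "sign_error (Suc m) t = 1/2 * (sign_error m t)\<^sup>2 * (3 - sign_error m t)" for t
    by (rule sign_error_Suc)
  show "1/2 * (sign_error m t)\<^sup>2 * (3 - sign_error m t) \<le> 3/2 * (sign_error m t)\<^sup>2"
    if "t \<in> {\<gamma>..1}" for t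
  proof -
    have "0 \<le> (sign_error m t)\<^sup>2 * sign_error m t"
      using that assms by (intro mult_nonneg_nonneg sign_error_nonneg) auto
    then show ?thesis by (simp add: algebra_simps)
  qed
  show max: "is_max_over (\<lambda>u. \<bar>poly (sign_poly m) u - sgn u\<bar>) {u. \<bar>u\<bar> \<in> {\<gamma>..1}} (sign_error m \<gamma>)"
    using assms by (rule sign_poly_max_error)
  show "spectral_norm (poly_matrix (sign_poly m) A - matrix_sign A) \<le> sign_error m \<gamma>"
    if sym: "transpose A = A" and spec: "matrix_spectrum A \<subseteq> {-1..-\<gamma>} \<union> {\<gamma>..1}"
    for A :: "real^'n^'n"
  proof (rule spectral_norm_poly_matrix_minus_sign_le[OF sym])
    show "0 \<notin> matrix_spectrum A"
      using spec assms by auto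
    show "\<bar>poly (sign_poly m) c - sgn c\<bar> \<le> sign_error m \<gamma>" if "c \<in> matrix_spectrum A" for c
    proof -
      have "\<bar>c\<bar> \<in> {\<gamma>..1}"
        using spec that assms by force
      then show ?thesis
        using max by (simp add: is_max_over_def)
    qed
  qed
qed

end
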